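(* Let $n\ge3$. Consider the following two assertions. (D) For all $\varphi\in H^1(\mathbb{R}^n)$ with $x\cdot\nabla\varphi\in L^2(\mathbb{R}^n)$, $$\|x\cdot\nabla\varphi\|^2=\Bigl\|x\cdot\nabla\varphi+\frac n2\varphi\Bigr\|^2+\left(\frac n2\right)^2\|\varphi\|^2.$$ (H) For all $\psi\in H^1(\mathbb{R}^n)$, $$\Bigl\|\frac{x}{|x|}\cdot\nabla\psi\Bigr\|^2=\Bigl\|\frac{x}{|x|}\cdot\nabla\psi+\frac{n-2}{2|x|}\psi\Bigr\|^2+\left(\frac{n-2}{2}\right)^2\Bigl\|\frac{\psi}{|x|}\Bigr\|^2.$$ Then (H) follows from (D). Conversely, (H) implies (D).
   Context: $L^2(\mathbb{R}^n)$ is the space of complex-valued square integrable functions with norm $\|\cdot\|$. $H^1(\mathbb{R}^n)=\{\varphi\in L^2(\mathbb{R}^n):\partial_j\varphi\in L^2(\mathbb{R}^n)\text{ for all }1\le j\le n\}$, with distributional derivatives. $|x|$ is the Euclidean length, $x\cdot\nabla\varphi=\sum_{j=1}^n x_j\partial_j\varphi$ and $\frac{x}{|x|}\cdot\nabla\psi=\sum_{j=1}^n\frac{x_j}{|x|}\partial_j\psi$. *)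

theory Defs
  imports "HOL-Analysis.Analysis"
begin

definition partial :: "'n::finite \<Rightarrow> (real^'n \<Rightarrow> complex) \<Rightarrow> real^'n \<Rightarrow> complex" where
  "partial j f x = frechet_derivative f (at x) (axis j 1)"

primrec C_k :: "nat \<Rightarrow> (real^'n::finite \<Rightarrow> complex) \<Rightarrow> bool" where
  "C_k 0 f \<longleftrightarrow> continuous_on UNIV f"
| "C_k (Suc k) f \<longleftrightarrow> (\<forall>x. f differentiable (at x)) \<and> (\<forall>j. C_k k (partial j f))"

definition test_functions :: "(real^'n::finite \<Rightarrow> complex) set" where
  "test_functions = {u. (\<forall>k. C_k k u) \<and> compact (closure {x. u x \<noteq> 0})}"

definition locally_integrable :: "(real^'n::finite \<Rightarrow> complex) \<Rightarrow> bool" where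
  "locally_integrable f \<longleftrightarrow>
     f \<in> borel_measurable lborel \<and> (\<forall>K. compact K \<longrightarrow> set_integrable lborel K f)"

definition has_weak_partial ::
    "'n::finite \<Rightarrow> (real^'n \<Rightarrow> complex) \<Rightarrow> (real^'n \<Rightarrow> complex) \<Rightarrow> bool" where
  "has_weak_partial j f g \<longleftrightarrow> locally_integrable f \<and> locally_integrable g \<and>
     (\<forall>u\<in>test_functions. (LINT x|lborel. f x * partial j u x) = - (LINT x|lborel. g x * u x))"

text \<open>
  Elements of the function spaces below are represented by actual functions rather than by
  classes modulo null sets; every class of Lebesgue measurable functions has a Borel
  representative. A weak gradient is therefore a relation, determined only up to null sets.
\<close>

definition has_weak_gradient ::
    "(real^'n::finite \<Rightarrow> complex) \<Rightarrow> ('n \<Rightarrow> real^'n \<Rightarrow> complex) \<Rightarrow> bool" where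
  "has_weak_gradient f g \<longleftrightarrow> (\<forall>j. has_weak_partial j f (g j))"

definition L2 :: "(real^'n::finite \<Rightarrow> complex) set" where
  "L2 = {f. f \<in> borel_measurable lborel \<and> integrable lborel (\<lambda>x. (cmod (f x))\<^sup>2)}"

text \<open>
  The norm takes the value \<open>\<infinity>\<close> outside \<open>L2\<close>. Hence an identity between squared norms whose
  left-hand side is finite also asserts that all functions on its right-hand side lie in \<open>L2\<close>.
\<close>

definition L2_norm :: "(real^'n::finite \<Rightarrow> complex) \<Rightarrow> ennreal" where
  "L2_norm f = (if f \<in> L2 then ennreal (sqrt (LINT x|lborel. (cmod (f x))\<^sup>2)) else \<infinity>)"

definition H1 :: "(real^'n::finite \<Rightarrow> complex) set" where
  "H1 = {f \<in> L2. \<forall>j. \<exists>g\<in>L2. has_weak_partial j f g}"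

text \<open>
  In the next two definitions \<open>g\<close> plays the role of the gradient: they are \<open>x \<cdot> \<nabla>f\<close> and
  \<open>(x / |x|) \<cdot> \<nabla>f\<close>. The latter is \<open>0\<close> at the origin by the convention for division by zero.
\<close>

definition dilation_deriv :: "('n::finite \<Rightarrow> real^'n \<Rightarrow> complex) \<Rightarrow> real^'n \<Rightarrow> complex" where
  "dilation_deriv g x = (\<Sum>j\<in>UNIV. of_real (x $ j) * g j x)"

definition radial_deriv :: "('n::finite \<Rightarrow> real^'n \<Rightarrow> complex) \<Rightarrow> real^'n \<Rightarrow> complex" where
  "radial_deriv g x = (\<Sum>j\<in>UNIV. of_real (x $ j / norm x) * g j x)"

end

theory Submission
  imports Defs
begin

text \<open>
  For \<open>a, b \<in> L2\<close> and \<open>c > 0\<close>, the identity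
  \<open>\<parallel>a\<parallel>\<^sup>2 = \<parallel>a + c b\<parallel>\<^sup>2 + c\<^sup>2 \<parallel>b\<parallel>\<^sup>2\<close> says \<open>Re \<langle>a, b\<rangle> = - c \<parallel>b\<parallel>\<^sup>2\<close>. Formally,
  (D) and (H) are exchanged by the substitution \<open>\<psi> = |x| \<phi>\<close>. As \<open>|x|\<close> and \<open>1 / |x|\<close> are neither
  smooth nor bounded, they are replaced by smooth radial multipliers depending on \<open>\<epsilon> > 0\<close>, bounded
  together with their gradients, so that the product rule for weak derivatives keeps us in \<open>H1\<close>.
  From (D) to (H) the multiplier is \<open>(|x|\<^sup>2 + \<epsilon>) powr (-1/2)\<close>; the identity (D) then bounds
  \<open>\<psi> / (|x|\<^sup>2 + \<epsilon>) powr (1/2)\<close> in \<open>L2\<close> uniformly in \<open>\<epsilon>\<close>, and Fatou's lemma gives \<open>\<psi> / |x| \<in> L2\<close>,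
  which dominates the passage to the limit. From (H) to (D) the multiplier is
  \<open>|x|\<^sup>2 (|x|\<^sup>2 + \<epsilon>) powr (-1/2) / (1 + \<epsilon> |x|\<^sup>2)\<close>.

  The gradient in (H) is any weak gradient, which is not known to lie in \<open>L2\<close> without uniqueness
  of weak derivatives. This causes no problem: if the radial derivative is not in \<open>L2\<close>,
  both sides of (H) are infinite.
\<close>

section \<open>Classical partial derivatives and the algebra of the classes
  \<open>C_k\<close>\<close>

lemma partial_eqI:
  assumes "(f has_derivative D) (at x)"
  shows "partial j f x = D (axis j 1)"
  using frechet_derivative_at[OF assms] by (simp add: partial_def)

lemma partial_add:
  assumes "f differentiable (at x)" "g differentiable (at x)"
  shows "partial j (\<lambda>x. f x + g x) x = partial j f x + partial j g x"
  unfolding partial_def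
  by (subst frechet_derivative_at[symmetric, OF has_derivative_add])
     (use assms frechet_derivative_works in auto)

lemma partial_mult:
  assumes "f differentiable (at x)" "g differentiable (at x)"
  shows "partial j (\<lambda>x. f x * g x) x = f x * partial j g x + partial j f x * g x"
  unfolding partial_def
  by (subst frechet_derivative_at[symmetric, OF has_derivative_mult])
     (use assms frechet_derivative_works in auto)

lemma C_k_imp_continuous: "C_k k f \<Longrightarrow> continuous_on UNIV f"
  by (cases k) (auto intro!: differentiable_imp_continuous_on simp: differentiable_on_def
      differentiable_at_withinI)

text \<open>The recursion asks for continuity only at its last level, so lowering the order rests on
  differentiability implying continuity. The product rule needs this, since \<open>f\<close> and
  \<open>g\<close> themselves reappear in the partial derivatives of \<open>f * g\<close>.\<close>

lemma C_k_SucD: "C_k (Suc k) f \<Longrightarrow> C_k k f"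
proof (induction k arbitrary: f)
  case 0
  then show ?case using C_k_imp_continuous[of "Suc 0" f] by simp
next
  case (Suc k)
  show ?case unfolding C_k.simps(2)
  proof (intro conjI allI)
    show "f differentiable (at x)" for x
      using Suc.prems unfolding C_k.simps(2)[of "Suc k"] by blast
    show "C_k k (partial j f)" for j
      using Suc.prems unfolding C_k.simps(2)[of "Suc k"] by (intro Suc.IH) blast
  qed
qed

lemma C_k_add: "C_k k f \<Longrightarrow> C_k k g \<Longrightarrow> C_k k (\<lambda>x. f x + g x)"
proof (induction k arbitrary: f g)
  case 0
  then show ?case by (auto intro!: continuous_intros)
next
  case (Suc k)
  then have "partial j (\<lambda>x. f x + g x) = (\<lambda>x. partial j f x + partial j g x)" for j
    by (auto intro!: ext partial_add)
  with Suc show ?case by auto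
qed

lemma C_k_mult: "C_k k f \<Longrightarrow> C_k k g \<Longrightarrow> C_k k (\<lambda>x. f x * g x)"
proof (induction k arbitrary: f g)
  case 0
  then show ?case by (auto intro!: continuous_intros)
next
  case (Suc k)
  then have "partial j (\<lambda>x. f x * g x) = (\<lambda>x. f x * partial j g x + partial j f x * g x)" for j
    by (auto intro!: ext partial_mult)
  moreover have "C_k k f" "C_k k g"
    using Suc.prems by (auto intro: C_k_SucD)
  ultimately show ?case
    using Suc by (auto intro!: C_k_add)
qed

lemma C_k_const: "C_k k (\<lambda>x :: real^'n::finite. c)"
proof (induction k arbitrary: c)
  case (Suc k)
  have "partial j (\<lambda>x :: real^'n. c) = (\<lambda>x. 0)" for j
    by (rule ext, subst partial_eqI[OF has_derivative_const]) simp
  with Suc show ?case by simp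
qed simp

lemma C_k_coord: "C_k k (\<lambda>x :: real^'n::finite. of_real (x $ i))"
proof (cases k)
  case 0
  then show ?thesis by (auto intro!: continuous_intros)
next
  case (Suc l)
  have D: "((\<lambda>x :: real^'n. of_real (x $ i) :: complex) has_derivative (\<lambda>h. of_real (h $ i))) (at x)" for x
    by (intro derivative_intros bounded_linear_imp_has_derivative bounded_linear_vec_nth)
  have "partial j (\<lambda>x :: real^'n. of_real (x $ i)) = (\<lambda>x. of_real (axis j 1 $ i))" for j
    by (rule ext, rule partial_eqI[OF D])
  with D show ?thesis by (auto simp: Suc C_k_const differentiable_def)
qed

section \<open>Smooth radial functions\<close>

text \<open>The profile \<open>M\<close> is a function of \<open>x \<bullet> x\<close> rather than
  of \<open>norm x\<close>, because the former is smooth at the origin as well.\<close>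

lemma has_derivative_radial:
  fixes x :: "real^'n::finite"
  assumes "(M has_real_derivative M') (at (x \<bullet> x))"
  shows "((\<lambda>x. of_real (M (x \<bullet> x)) :: complex) has_derivative
    (\<lambda>h. of_real (M' * (2 * (x \<bullet> h))))) (at x)"
proof -
  have "((\<lambda>x. x \<bullet> x) has_derivative (\<lambda>h. 2 * (x \<bullet> h))) (at x)"
    by (auto intro!: derivative_eq_intros simp: inner_commute)
  from has_derivative_compose[OF this assms[unfolded has_field_derivative_def]]
  show ?thesis by (intro has_derivative_of_real)
qed

lemma partial_radial:
  fixes x :: "real^'n::finite"
  assumes "(M has_real_derivative M') (at (x \<bullet> x))"
  shows "partial j (\<lambda>x. of_real (M (x \<bullet> x))) x = of_real (2 * M' * x $ j)"
  using partial_eqI[OF has_derivative_radial[OF assms]] by (simp add: inner_axis)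

text \<open>Differentiation lowers the exponent by one and produces a coordinate factor, so the
  family is closed under it; hence the induction treats all exponents at once. The shift
  \<open>s > 0\<close> keeps the base of the power positive.\<close>

lemma C_k_radial_powr:
  assumes "s > 0"
  shows "C_k k (\<lambda>x :: real^'n::finite. of_real ((x \<bullet> x + s) powr a))"
proof (induction k arbitrary: a)
  case 0
  have "x \<bullet> x + s \<noteq> 0" for x :: "real^'n"
    using assms inner_ge_zero[of x] by linarith
  then show ?case by (auto intro!: continuous_intros)
next
  case (Suc k)
  have pos: "x \<bullet> x + s > 0" for x :: "real^'n"
    using assms inner_ge_zero[of x] by linarith
  have D: "((\<lambda>t. (t + s) powr a) has_real_derivative a * (x \<bullet> x + s) powr (a - 1)) (at (x \<bullet> x))"
    for x :: "real^'n"
    using pos[of x] by (auto intro!: derivative_eq_intros)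
  have "partial j (\<lambda>x :: real^'n. of_real ((x \<bullet> x + s) powr a)) =
      (\<lambda>x. of_real (2 * a) * (of_real ((x \<bullet> x + s) powr (a - 1)) * of_real (x $ j)))" for j
    by (rule ext, subst partial_radial[OF D]) simp
  then have "C_k k (partial j (\<lambda>x :: real^'n. of_real ((x \<bullet> x + s) powr a)))" for j
    using Suc by (auto intro!: C_k_mult C_k_const C_k_coord simp del: of_real_mult)
  with has_derivative_radial[OF D] show ?case
    by (auto simp: differentiable_def)
qed

section \<open>Product rule for weak derivatives\<close>

lemma locally_integrable_mult_continuous:
  assumes "locally_integrable f" "continuous_on UNIV m"
  shows "locally_integrable (\<lambda>x. m x * f x)"
  unfolding locally_integrable_def
proof (intro conjI allI impI)
  have f: "f \<in> borel_measurable lborel" and m: "m \<in> borel_measurable lborel"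
    using assms borel_measurable_continuous_onI by (auto simp: locally_integrable_def)
  show "(\<lambda>x. m x * f x) \<in> borel_measurable lborel"
    using f m by measurable
  fix K :: "(real^'a) set" assume K: "compact K"
  then have "compact (m ` K)"
    by (intro compact_continuous_image continuous_on_subset[OF assms(2)]) auto
  then obtain B where B: "\<And>x. x \<in> K \<Longrightarrow> cmod (m x) \<le> B"
    by (meson bounded_iff compact_imp_bounded imageI)
  have Km: "K \<in> sets borel" using K by (simp add: borel_compact)
  have int: "integrable lborel (\<lambda>x. of_real B * (indicator K x *\<^sub>R f x))"
    using assms(1) K unfolding locally_integrable_def set_integrable_def
    by (intro integrable_mult_right) blast
  show "set_integrable lborel K (\<lambda>x. m x * f x)"
    unfolding set_integrable_def
  proof (rule Bochner_Integration.integrable_bound[OF int])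
    show "(\<lambda>x. indicator K x *\<^sub>R (m x * f x)) \<in> borel_measurable lborel"
      using f m Km by measurable
    show "AE x in lborel. cmod (indicator K x *\<^sub>R (m x * f x))
      \<le> cmod (of_real B * (indicator K x *\<^sub>R f x))"
    proof (rule AE_I2)
      show "cmod (indicator K x *\<^sub>R (m x * f x)) \<le> cmod (of_real B * (indicator K x *\<^sub>R f x))" for x
        using B[of x] mult_right_mono[of "cmod (m x)" "\<bar>B\<bar>" "cmod (f x)"]
        by (cases "x \<in> K") (auto simp: norm_mult)
    qed
  qed
qed

lemma locally_integrable_add:
  "locally_integrable f \<Longrightarrow> locally_integrable g \<Longrightarrow> locally_integrable (\<lambda>x. f x + g x)"
  unfolding locally_integrable_def by (auto intro!: set_integral_add)

lemma integrable_mult_compact_support: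
  assumes "locally_integrable f" "continuous_on UNIV u" "compact K" "\<And>x. x \<notin> K \<Longrightarrow> u x = 0"
  shows "integrable lborel (\<lambda>x. u x * f x)"
proof -
  have "set_integrable lborel K (\<lambda>x. u x * f x)"
    using locally_integrable_mult_continuous[OF assms(1,2)] assms(3)
    by (auto simp: locally_integrable_def)
  moreover have "indicator K x *\<^sub>R (u x * f x) = u x * f x" for x
    using assms(4) by (cases "x \<in> K") auto
  ultimately show ?thesis
    by (simp add: set_integrable_def)
qed

lemma partial_eq_0_outside_support:
  assumes "x \<notin> closure {x. u x \<noteq> 0}"
  shows "partial j u x = 0"
proof -
  have "((\<lambda>x. 0) has_derivative (\<lambda>h. 0)) (at x)" by simp
  then have "(u has_derivative (\<lambda>h. 0)) (at x)"
    by (rule has_derivative_transform_within_open[of _ _ _ _ "- closure {x. u x \<noteq> 0}"])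
      (use assms closure_subset[of "{x. u x \<noteq> 0}"] in auto)
  from partial_eqI[OF this] show ?thesis by simp
qed

lemma test_functions_mult:
  assumes "u \<in> test_functions" "\<And>k. C_k k m"
  shows "(\<lambda>x. m x * u x) \<in> test_functions"
proof -
  have "closure {x. m x * u x \<noteq> 0} \<subseteq> closure {x. u x \<noteq> 0}"
    by (rule closure_mono) auto
  then have "compact (closure {x. m x * u x \<noteq> 0})"
    using assms(1) compact_Int_closed[of "closure {x. u x \<noteq> 0}" "closure {x. m x * u x \<noteq> 0}"]
    by (auto simp: test_functions_def Int_absorb1)
  then show ?thesis
    using assms by (auto simp: test_functions_def intro: C_k_mult)
qed

text \<open>The weak derivative of \<open>f\<close> is tested against \<open>m * u\<close>, again a
  test function. Expanding \<open>partial j (m * u)\<close> by the classical product rule leaves the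
  wanted integral and a term with \<open>partial j m\<close>. The integrals may be split because
  \<open>u\<close> confines every integrand to a compact set.\<close>

lemma has_weak_partial_mult:
  assumes m: "\<And>k. C_k k m" and fg: "has_weak_partial j f g"
  shows "has_weak_partial j (\<lambda>x. m x * f x) (\<lambda>x. m x * g x + partial j m x * f x)"
proof -
  have C1: "continuous_on UNIV v \<and> continuous_on UNIV (partial j v) \<and> (\<forall>x. v differentiable (at x))"
    if "\<And>k. C_k k v" for v :: "real^'a \<Rightarrow> complex"
    using that[of 1] C_k_imp_continuous[of 1 v] by auto
  have f: "locally_integrable f" and g: "locally_integrable g"
    using fg by (auto simp: has_weak_partial_def)
  have "(LINT x|lborel. m x * f x * partial j u x) =
      - (LINT x|lborel. (m x * g x + partial j m x * f x) * u x)"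
    if u: "u \<in> test_functions" for u
  proof -
    let ?K = "closure {x. u x \<noteq> 0}"
    have K: "compact ?K" and Ck: "\<And>k. C_k k u" using u by (auto simp: test_functions_def)
    have u0: "u x = 0" if "x \<notin> ?K" for x
      using that closure_subset[of "{x. u x \<noteq> 0}"] by auto
    have p: "partial j (\<lambda>x. m x * u x) x = m x * partial j u x + partial j m x * u x" for x
      using C1[OF m] C1[OF Ck] by (intro partial_mult) auto
    note cont = continuous_on_mult C1[OF m, THEN conjunct1] C1[OF Ck, THEN conjunct1]
      C1[OF m, THEN conjunct2, THEN conjunct1] C1[OF Ck, THEN conjunct2, THEN conjunct1]
    have i1: "integrable lborel (\<lambda>x. (m x * partial j u x) * f x)"
      using partial_eq_0_outside_support[of _ u j]
      by (intro integrable_mult_compact_support[OF f _ K] cont) simp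
    have i2: "integrable lborel (\<lambda>x. (partial j m x * u x) * f x)"
      by (intro integrable_mult_compact_support[OF f _ K] cont) (subst u0, assumption, simp)
    have i3: "integrable lborel (\<lambda>x. (m x * u x) * g x)"
      by (intro integrable_mult_compact_support[OF g _ K] cont) (subst u0, assumption, simp)
    have "(LINT x|lborel. (m x * partial j u x) * f x) + (LINT x|lborel. (partial j m x * u x) * f x)
        = (LINT x|lborel. f x * partial j (\<lambda>x. m x * u x) x)"
      unfolding Bochner_Integration.integral_add[OF i1 i2, symmetric]
      by (simp add: p algebra_simps)
    also have "\<dots> = - (LINT x|lborel. g x * (m x * u x))"
      using fg test_functions_mult[OF u m] by (auto simp: has_weak_partial_def)
    finally have "(LINT x|lborel. (m x * partial j u x) * f x) =
        - ((LINT x|lborel. (m x * u x) * g x) + (LINT x|lborel. (partial j m x * u x) * f x))"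
      by (simp add: mult.commute[of "g _"] eq_diff_eq)
    also have "\<dots> = - (LINT x|lborel. (m x * u x) * g x + (partial j m x * u x) * f x)"
      unfolding Bochner_Integration.integral_add[OF i3 i2] ..
    finally show ?thesis
      by (simp add: algebra_simps)
  qed
  then show ?thesis
    unfolding has_weak_partial_def
    using C1[OF m] by (intro conjI ballI locally_integrable_add locally_integrable_mult_continuous f g) blast+
qed

section \<open>Square integrable functions and identities between their norms\<close>

lemma L2_add:
  assumes "f \<in> L2" "g \<in> L2"
  shows "(\<lambda>x. f x + g x) \<in> L2"
proof -
  have [measurable]: "f \<in> borel_measurable lborel" "g \<in> borel_measurable lborel"
    using assms by (auto simp: L2_def)
  have int: "integrable lborel (\<lambda>x. 2 * (cmod (f x))\<^sup>2 + 2 * (cmod (g x))\<^sup>2)"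
    using assms by (auto simp: L2_def)
  have "(cmod (a + b))\<^sup>2 \<le> 2 * (cmod a)\<^sup>2 + 2 * (cmod b)\<^sup>2" for a b
  proof -
    have "(cmod (a + b))\<^sup>2 \<le> (cmod a + cmod b)\<^sup>2"
      by (intro power_mono norm_triangle_ineq) auto
    also have "\<dots> \<le> 2 * (cmod a)\<^sup>2 + 2 * (cmod b)\<^sup>2"
      using zero_le_power2[of "cmod a - cmod b"] by (simp add: power2_eq_square algebra_simps)
    finally show ?thesis .
  qed
  then have "integrable lborel (\<lambda>x. (cmod (f x + g x))\<^sup>2)"
    by (intro Bochner_Integration.integrable_bound[OF int]) auto
  then show ?thesis by (auto simp: L2_def)
qed

lemma L2_bounded_mult:
  assumes "f \<in> L2" "m \<in> borel_measurable lborel" "\<And>x. cmod (m x) \<le> B"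
  shows "(\<lambda>x. m x * f x) \<in> L2"
proof -
  have [measurable]: "f \<in> borel_measurable lborel" "m \<in> borel_measurable lborel"
    using assms by (auto simp: L2_def)
  have int: "integrable lborel (\<lambda>x. B\<^sup>2 * (cmod (f x))\<^sup>2)"
    using assms by (auto simp: L2_def)
  have "integrable lborel (\<lambda>x. (cmod (m x * f x))\<^sup>2)"
    by (rule Bochner_Integration.integrable_bound[OF int])
      (auto simp: norm_mult power_mult_distrib intro!: mult_right_mono power_mono assms)
  then show ?thesis by (auto simp: L2_def)
qed

lemma integrable_L2_inner:
  assumes "a \<in> L2" "b \<in> L2"
  shows "integrable lborel (\<lambda>x. cmod (a x) * cmod (b x))"
    and "integrable lborel (\<lambda>x. Re (a x * cnj (b x)))"
proof -
  have [measurable]: "a \<in> borel_measurable lborel" "b \<in> borel_measurable lborel"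
    using assms by (auto simp: L2_def)
  have int: "integrable lborel (\<lambda>x. (cmod (a x))\<^sup>2 + (cmod (b x))\<^sup>2)"
    using assms by (auto simp: L2_def)
  have *: "s * t \<le> s\<^sup>2 + t\<^sup>2" if "s \<ge> 0" "t \<ge> 0" for s t :: real
    using that zero_le_power2[of "s - t"] mult_nonneg_nonneg[OF that]
    unfolding power2_diff by linarith
  show i: "integrable lborel (\<lambda>x. cmod (a x) * cmod (b x))"
    by (rule Bochner_Integration.integrable_bound[OF int]) (auto intro!: *)
  have [measurable]: "(\<lambda>x. cnj (b x)) \<in> borel_measurable lborel"
    by (rule measurable_compose[OF _ borel_measurable_continuous_onI[of cnj]])
      (auto intro!: continuous_intros)
  show "integrable lborel (\<lambda>x. Re (a x * cnj (b x)))"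
    by (rule Bochner_Integration.integrable_bound[OF i], measurable)
      (metis (no_types, lifting) AE_I2 abs_Re_le_cmod abs_mult abs_norm_cancel complex_mod_cnj norm_mult
        real_norm_def)
qed

lemma L2_norm_power2:
  "f \<in> L2 \<Longrightarrow> (L2_norm f)\<^sup>2 = ennreal (LINT x|lborel. (cmod (f x))\<^sup>2)"
  by (simp add: L2_norm_def ennreal_power)

text \<open>Expanding the square of \<open>a + c * b\<close> cancels the square of \<open>a\<close>
  and leaves a multiple of \<open>c > 0\<close>. Both (D) and (H) thereby become identities between
  real integrals, on which limits can be taken.\<close>

lemma L2_identity_iff:
  assumes a: "a \<in> L2" and b: "b \<in> L2" and c: "c > 0"
  shows "(L2_norm a)\<^sup>2 = (L2_norm (\<lambda>x. a x + of_real c * b x))\<^sup>2 + ennreal (c\<^sup>2) * (L2_norm b)\<^sup>2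
    \<longleftrightarrow> (LINT x|lborel. Re (a x * cnj (b x))) = - c * (LINT x|lborel. (cmod (b x))\<^sup>2)"
proof -
  let ?A = "LINT x|lborel. (cmod (a x))\<^sup>2" and ?B = "LINT x|lborel. (cmod (b x))\<^sup>2"
    and ?I = "LINT x|lborel. Re (a x * cnj (b x))"
  have s: "(\<lambda>x. a x + of_real c * b x) \<in> L2"
    by (intro L2_add a L2_bounded_mult[OF b, of _ "\<bar>c\<bar>"]) auto
  have "(LINT x|lborel. (cmod (a x + of_real c * b x))\<^sup>2) =
    (LINT x|lborel. (cmod (a x))\<^sup>2 + (2 * c) * Re (a x * cnj (b x)) + c\<^sup>2 * (cmod (b x))\<^sup>2)"
    by (rule Bochner_Integration.integral_cong)
      (simp_all add: cmod_power2, simp add: power2_eq_square algebra_simps)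
  also have "\<dots> = ?A + 2 * c * ?I + c\<^sup>2 * ?B"
    using a b integrable_L2_inner[OF a b] by (simp add: L2_def)
  finally have e: "(LINT x|lborel. (cmod (a x + of_real c * b x))\<^sup>2) = ?A + 2 * c * ?I + c\<^sup>2 * ?B" .
  \<comment> \<open>The first sum is the integral of a square. Its sign cannot be seen from the
    expanded form, but it is needed because \<open>ennreal\<close> is injective only on nonnegative
    reals.\<close>
  have nn: "?A + 2 * c * ?I + c\<^sup>2 * ?B \<ge> 0" "?B \<ge> 0" "?A \<ge> 0"
    unfolding e[symmetric] by auto
  have "?A = ?A + 2 * c * ?I + c\<^sup>2 * ?B + c\<^sup>2 * ?B \<longleftrightarrow> 2 * c * (?I + c * ?B) = 0"
    by (simp add: algebra_simps power2_eq_square)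
  also have "\<dots> \<longleftrightarrow> ?I = - c * ?B"
    using c by (simp add: add_eq_0_iff2)
  finally have iff: "?A = ?A + 2 * c * ?I + c\<^sup>2 * ?B + c\<^sup>2 * ?B \<longleftrightarrow> ?I = - c * ?B" .
  have "(L2_norm (\<lambda>x. a x + of_real c * b x))\<^sup>2 + ennreal (c\<^sup>2) * (L2_norm b)\<^sup>2 =
      ennreal (?A + 2 * c * ?I + c\<^sup>2 * ?B + c\<^sup>2 * ?B)"
    unfolding L2_norm_power2[OF b] L2_norm_power2[OF s] e
    by (subst ennreal_mult[symmetric], simp, rule nn(2))
      (rule ennreal_plus[symmetric], use nn in auto)
  moreover have "0 \<le> ?A + 2 * c * ?I + c\<^sup>2 * ?B + c\<^sup>2 * ?B"
    using nn by (intro add_nonneg_nonneg[of "?A + 2 * c * ?I + c\<^sup>2 * ?B"]) auto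
  ultimately show ?thesis
    unfolding L2_norm_power2[OF a] iff[symmetric]
    using nn(3) ennreal_inj by presburger
qed

section \<open>Smooth multipliers on \<open>H1\<close>, and the dilation and radial
  derivatives\<close>

lemma H1_mult:
  assumes "f \<in> H1" "\<And>k. C_k k m" "\<And>x. cmod (m x) \<le> B" "\<And>j x. cmod (partial j m x) \<le> B'"
  shows "(\<lambda>x. m x * f x) \<in> H1"
proof -
  have "continuous_on UNIV m" "\<And>j. continuous_on UNIV (partial j m)"
    using assms(2)[of 1] C_k_imp_continuous[of 1 m] by auto
  then have meas: "m \<in> borel_measurable lborel" "\<And>j. partial j m \<in> borel_measurable lborel"
    by (auto intro: borel_measurable_continuous_onI)
  have f: "f \<in> L2" using assms(1) by (simp add: H1_def)
  have "\<exists>g\<in>L2. has_weak_partial j (\<lambda>x. m x * f x) g" for j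
  proof -
    obtain g where g: "g \<in> L2" "has_weak_partial j f g"
      using assms(1) by (auto simp: H1_def)
    show ?thesis
      using has_weak_partial_mult[OF assms(2) g(2)]
        L2_add[OF L2_bounded_mult[OF g(1) meas(1) assms(3)] L2_bounded_mult[OF f meas(2) assms(4)]]
      by blast
  qed
  then show ?thesis
    using L2_bounded_mult[OF f meas(1) assms(3)] by (simp add: H1_def)
qed

text \<open>For a radial multiplier with profile derivative \<open>M'\<close> the gradient is
  \<open>2 * M'\<close> times \<open>x\<close>, so its dilation derivative is
  \<open>2 * M' * (x \<bullet> x)\<close>.\<close>

lemma dilation_deriv_radial_mult:
  assumes "\<And>j. partial j m x = of_real (2 * M' * x $ j)"
  shows "dilation_deriv (\<lambda>j x. m x * g j x + partial j m x * f x) x =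
    m x * dilation_deriv g x + of_real (2 * M' * (x \<bullet> x)) * f x"
  unfolding dilation_deriv_def assms
  by (simp add: algebra_simps sum.distrib sum_distrib_left sum_distrib_right inner_vec_def)

lemma radial_deriv_eq: "radial_deriv g x = dilation_deriv g x / of_real (norm x)"
  by (simp add: radial_deriv_def dilation_deriv_def sum_divide_distrib)

text \<open>Holds at every point: at the origin both sides vanish, whatever value the radial
  derivative has there.\<close>

lemma dilation_deriv_eq: "dilation_deriv g x = of_real (norm x) * radial_deriv g x"
  by (cases "x = 0") (auto simp: radial_deriv_eq, simp add: dilation_deriv_def)

lemma has_weak_gradient_mult:
  assumes "\<And>k. C_k k m" "has_weak_gradient f g"
  shows "has_weak_gradient (\<lambda>x. m x * f x) (\<lambda>j x. m x * g j x + partial j m x * f x)"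
  using assms by (auto simp: has_weak_gradient_def intro: has_weak_partial_mult)

section \<open>From (D) to (H)\<close>

text \<open>Here \<open>d\<close> stands for n/2. Testing the dilation identity on
  \<open>m k x * f x\<close> produces the coefficient \<open>d - s k x\<close>, at least
  \<open>d - 1 > 0\<close>. This positivity gives a bound uniform in \<open>k\<close>, and letting
  \<open>k\<close> grow turns the coefficient into \<open>d - 1\<close>.\<close>

lemma dilation_identity_imp_Hardy:
  fixes f :: "real^'n::finite \<Rightarrow> complex"
  assumes D: "\<And>(\<phi> :: real^'n \<Rightarrow> complex) g.
      \<phi> \<in> H1 \<Longrightarrow> has_weak_gradient \<phi> g \<Longrightarrow> dilation_deriv g \<in> L2 \<Longrightarrow>
      (LINT x|lborel. Re (dilation_deriv g x * cnj (\<phi> x))) = - d * (LINT x|lborel. (cmod (\<phi> x))\<^sup>2)"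
    and d: "d > 1" and f: "f \<in> H1" "has_weak_gradient f g" and a: "radial_deriv g \<in> L2"
  shows "(\<lambda>x. f x / of_real (norm x)) \<in> L2"
    and "(LINT x|lborel. Re (radial_deriv g x * cnj (f x / of_real (norm x)))) =
      - (d - 1) * (LINT x|lborel. (cmod (f x / of_real (norm x)))\<^sup>2)"
proof -
  define e where "e k = inverse (real (Suc k))" for k
  \<comment> \<open>\<open>m\<close> approximates 1/|x| from below, and \<open>s\<close> measures
    the quality of the approximation: it lies between 0 and 1 and tends to 1 away from the
    origin.\<close>
  define m where "m k x = (x \<bullet> x + e k) powr (- 1 / 2)" for k and x :: "real^'n"
  define s where "s k x = (norm x * m k x)\<^sup>2" for k x
  define N where "N x = (cmod (f x))\<^sup>2" for x
  define P where "P x = Re (radial_deriv g x * cnj (f x / of_real (norm x)))" for x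
  have e: "e k > 0" for k by (simp add: e_def)
  have pos: "x \<bullet> x + e k > 0" for x :: "real^'n" and k
    using e[of k] inner_ge_zero[of x] by linarith
  have m0: "m k x \<ge> 0" for k x by (simp add: m_def)
  have m2: "(m k x)\<^sup>2 = 1 / (x \<bullet> x + e k)" for k x
    using pos[of x k] by (simp add: m_def powr_minus_divide power2_eq_square flip: powr_add)
  have m2_le: "(m k x)\<^sup>2 \<le> 1 / e k" for k x
    unfolding m2 using e[of k] by (intro divide_left_mono) (auto simp: pos)
  have s_eq: "s k x = (x \<bullet> x) / (x \<bullet> x + e k)" for k x
    by (simp add: s_def power_mult_distrib m2 power2_norm_eq_inner)
  have s01: "0 \<le> s k x" "s k x \<le> 1" for k x
    using pos[of x k] e[of k] unfolding s_eq by (auto simp: divide_le_eq_1)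
  have rm: "norm x * m k x \<le> 1" for k x
    using s01(2)[of k x] m0[of k x] unfolding s_def by (simp add: abs_square_le_1)
  have m_le: "\<bar>m k x\<bar> \<le> sqrt (1 / e k)" for k x
    by (rule real_le_rsqrt) (simp add: m2_le)
  have M': "((\<lambda>t. (t + e k) powr (- 1 / 2)) has_real_derivative - ((m k x) ^ 3) / 2) (at (x \<bullet> x))"
    for k and x :: "real^'n"
  proof -
    have "(x \<bullet> x + e k) powr (- 1 / 2 - 1) = m k x * (m k x)\<^sup>2"
      unfolding powr_diff m2 using pos[of x k] by (simp add: m_def)
    then show ?thesis
      using pos[of x k] by (auto intro!: derivative_eq_intros simp: power3_eq_cube power2_eq_square)
  qed
  have pm: "partial j (\<lambda>x. of_real (m k x)) x = of_real (2 * (- ((m k x) ^ 3) / 2) * x $ j)" for j k x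
    using partial_radial[OF M'] unfolding m_def .
  have pm_le: "cmod (partial j (\<lambda>x. of_real (m k x)) x) \<le> 1 / e k" for j k x
  proof -
    \<comment> \<open>The partial derivative has modulus
      \<open>\<bar>x $ j\<bar> * (m k x) ^ 3\<close>. One factor \<open>m\<close> absorbs the
      coordinate, and the other two give \<open>1 / e k\<close>.\<close>
    have "\<bar>x $ j\<bar> * m k x \<le> 1"
      using component_le_norm_cart[of x j] rm[of x k] mult_right_mono[OF _ m0[of k x]]
      by (meson order_trans)
    then have "(m k x)\<^sup>2 * (\<bar>x $ j\<bar> * m k x) \<le> 1 / e k * 1"
      by (intro mult_mono m2_le) (auto simp: m0 less_imp_le[OF e])
    then show ?thesis
      unfolding pm norm_of_real using m0[of k x]
      by (simp add: abs_mult power3_eq_cube power2_eq_square mult_ac)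
  qed
  have Cm: "C_k l (\<lambda>x. of_real (m k x))" for k l
    unfolding m_def by (rule C_k_radial_powr[OF e])
  have [measurable]: "(\<lambda>x. m k x) \<in> borel_measurable lborel" for k
    unfolding m_def using pos by (auto intro!: borel_measurable_continuous_onI continuous_intros simp: less_imp_neq[symmetric])
  have [measurable]: "f \<in> borel_measurable lborel"
    using f by (simp add: H1_def L2_def)
  have [measurable]: "radial_deriv g \<in> borel_measurable lborel"
    using a by (simp add: L2_def)
  have fL2: "f \<in> L2" using f by (simp add: H1_def)
  have [measurable]: "N \<in> borel_measurable lborel" "(\<lambda>x. s k x) \<in> borel_measurable lborel" for k
    unfolding N_def[abs_def] s_def by measurable
  let ?c = "d - 1"

  have mN: "integrable lborel (\<lambda>x. (m k x)\<^sup>2 * N x)"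
    and sP: "integrable lborel (\<lambda>x. s k x * P x)"
    and key: "(LINT x|lborel. s k x * P x) = - (LINT x|lborel. (d - s k x) * ((m k x)\<^sup>2 * N x))"
    and smN: "integrable lborel (\<lambda>x. (d - s k x) * ((m k x)\<^sup>2 * N x))" for k
  proof -
    let ?\<phi> = "\<lambda>x. of_real (m k x) * f x"
    let ?G = "\<lambda>j x. of_real (m k x) * g j x + partial j (\<lambda>x. of_real (m k x)) x * f x"
    have \<phi>: "?\<phi> \<in> H1"
      by (rule H1_mult[OF f(1) Cm, of _ "sqrt (1 / e k)" "1 / e k"])
        (use m_le pm_le in auto)
    then have \<phi>2: "?\<phi> \<in> L2" by (simp add: H1_def)
    \<comment> \<open>Both coefficients are bounded for fixed \<open>k\<close>, so the regularised
      function is admissible for \<open>D\<close> although only the radial derivative of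
      \<open>f\<close> is assumed to be in \<open>L2\<close>.\<close>
    have G: "dilation_deriv ?G x = of_real (norm x * m k x) * radial_deriv g x
        + of_real (- s k x * m k x) * f x" for x
      by (subst dilation_deriv_radial_mult[OF pm])
        (simp add: dilation_deriv_eq s_def power2_norm_eq_inner[symmetric] power2_eq_square
          power3_eq_cube mult_ac)
    have "(\<lambda>x. of_real (norm x * m k x) * radial_deriv g x) \<in> L2"
      using rm[of _ k] m0[of k] by (intro L2_bounded_mult[OF a, of _ 1]) (auto simp: norm_mult)
    moreover have "cmod (of_real (- s k x * m k x)) \<le> 1 * sqrt (1 / e k)" for x
      unfolding norm_of_real abs_mult using s01[of k x] m_le[of k x] by (intro mult_mono) auto
    then have "(\<lambda>x. of_real (- s k x * m k x) * f x) \<in> L2"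
      by (intro L2_bounded_mult[OF fL2, of _ "1 * sqrt (1 / e k)"]) auto
    ultimately have GL2: "dilation_deriv ?G \<in> L2"
      unfolding G by (rule L2_add)
    show mN: "integrable lborel (\<lambda>x. (m k x)\<^sup>2 * N x)"
      using \<phi>2 by (simp add: L2_def norm_mult power_mult_distrib N_def)
    have smN: "integrable lborel (\<lambda>x. s k x * ((m k x)\<^sup>2 * N x))"
      by (rule Bochner_Integration.integrable_bound[OF mN])
        (use s01 in \<open>auto simp: abs_mult N_def intro!: AE_I2 mult_left_le_one_le\<close>)
    then show i: "integrable lborel (\<lambda>x. (d - s k x) * ((m k x)\<^sup>2 * N x))"
      using mN by (simp add: left_diff_distrib)
    have eq: "Re (dilation_deriv ?G x * cnj (?\<phi> x)) = s k x * P x - s k x * ((m k x)\<^sup>2 * N x)" for x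
      unfolding G P_def N_def s_def
      by (cases "x = 0") (auto simp: cmod_power2, simp add: power2_eq_square field_simps)
    have int: "integrable lborel (\<lambda>x. s k x * P x - s k x * ((m k x)\<^sup>2 * N x))"
      using integrable_L2_inner(2)[OF GL2 \<phi>2] unfolding eq .
    from Bochner_Integration.integrable_add[OF int smN]
    show sP: "integrable lborel (\<lambda>x. s k x * P x)" by simp
    have "(LINT x|lborel. s k x * P x - s k x * ((m k x)\<^sup>2 * N x)) =
        - d * (LINT x|lborel. (m k x)\<^sup>2 * N x)"
      using D[OF \<phi> has_weak_gradient_mult[OF Cm f(2)] GL2]
      unfolding eq by (simp add: norm_mult power_mult_distrib N_def)
    then show "(LINT x|lborel. s k x * P x) = - (LINT x|lborel. (d - s k x) * ((m k x)\<^sup>2 * N x))"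
      using sP smN mN by (simp add: left_diff_distrib)
  qed

  let ?A = "LINT x|lborel. (cmod (radial_deriv g x))\<^sup>2"
  have aint: "integrable lborel (\<lambda>x. (cmod (radial_deriv g x))\<^sup>2)"
    using a by (simp add: L2_def)
  \<comment> \<open>Young's inequality is weighted by \<open>?c = d - 1\<close> so that the term it
    returns is \<open>?c / 2\<close> times the integral on the left, hence can be absorbed. The
    resulting bound is independent of \<open>k\<close>.\<close>
  have Hardy: "(LINT x|lborel. (m k x)\<^sup>2 * N x) \<le> ?A / ?c\<^sup>2" for k
  proof -
    have pw: "- (s k x * P x) \<le> 1 / (2 * ?c) * (cmod (radial_deriv g x))\<^sup>2 + ?c / 2 * ((m k x)\<^sup>2 * N x)"
      for x
    proof -
      let ?\<alpha> = "cmod (radial_deriv g x)" and ?\<beta> = "m k x * cmod (f x)"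
      have "cmod (radial_deriv g x * cnj (f x / of_real (norm x))) = ?\<alpha> * (cmod (f x) / norm x)"
        by (simp only: norm_mult complex_mod_cnj norm_divide norm_of_real abs_norm_cancel)
      then have "- P x \<le> ?\<alpha> * (cmod (f x) / norm x)"
        unfolding P_def
        using abs_Re_le_cmod[of "radial_deriv g x * cnj (f x / of_real (norm x))"] by linarith
      then have "- (s k x * P x) \<le> s k x * (?\<alpha> * (cmod (f x) / norm x))"
        using mult_left_mono[OF _ s01(1)[of k x]] by fastforce
      also have "\<dots> = (norm x * m k x) * (?\<alpha> * ?\<beta>)"
        by (cases "x = 0") (auto simp: s_def power2_eq_square)
      also have "\<dots> \<le> ?\<alpha> * ?\<beta>"
        using rm[of x k] m0[of k x] by (intro mult_left_le_one_le) auto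
      also have "\<dots> \<le> 1 / (2 * ?c) * ?\<alpha>\<^sup>2 + ?c / 2 * ?\<beta>\<^sup>2"
        using zero_le_power2[of "?\<alpha> - ?c * ?\<beta>"] d
        by (simp add: power2_eq_square field_simps)
      finally show ?thesis by (simp add: N_def power_mult_distrib)
    qed
    have "?c * (LINT x|lborel. (m k x)\<^sup>2 * N x) = (LINT x|lborel. ?c * ((m k x)\<^sup>2 * N x))"
      by simp
    also have "\<dots> \<le> (LINT x|lborel. (d - s k x) * ((m k x)\<^sup>2 * N x))"
      using s01[of k] by (intro integral_mono mN smN integrable_mult_right mult_right_mono) (auto simp: N_def)
    also have "\<dots> = (LINT x|lborel. - (s k x * P x))"
      using key[of k] by simp
    also have "\<dots> \<le> (LINT x|lborel. 1 / (2 * ?c) * (cmod (radial_deriv g x))\<^sup>2 + ?c / 2 * ((m k x)\<^sup>2 * N x))"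
      using pw by (intro integral_mono integrable_minus sP Bochner_Integration.integrable_add
          integrable_mult_right mN aint) auto
    also have "\<dots> = 1 / (2 * ?c) * ?A + ?c / 2 * (LINT x|lborel. (m k x)\<^sup>2 * N x)"
      using mN[of k] aint by (subst Bochner_Integration.integral_add) auto
    finally have "?c / 2 * (LINT x|lborel. (m k x)\<^sup>2 * N x) \<le> 1 / (2 * ?c) * ?A"
      by (simp add: field_simps)
    from mult_left_mono[OF this, of "2 * ?c"] show ?thesis
      using d by (simp add: pos_le_divide_eq) (simp add: power2_eq_square algebra_simps)
  qed

  have e_lim: "e \<longlonglongrightarrow> 0"
    unfolding e_def[abs_def] by (rule LIMSEQ_inverse_real_of_nat)
  have m_lim: "(\<lambda>k. (m k x)\<^sup>2) \<longlonglongrightarrow> 1 / (norm x)\<^sup>2" and s_lim: "(\<lambda>k. s k x) \<longlonglongrightarrow> 1" if "x \<noteq> 0" for x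
  proof -
    have nz: "x \<bullet> x + 0 \<noteq> 0" using that by simp
    have "(\<lambda>k. 1 / (x \<bullet> x + e k)) \<longlonglongrightarrow> 1 / (x \<bullet> x + 0)"
      using nz by (intro tendsto_intros e_lim)
    then show "(\<lambda>k. (m k x)\<^sup>2) \<longlonglongrightarrow> 1 / (norm x)\<^sup>2"
      by (simp add: m2 power2_norm_eq_inner)
    have "(\<lambda>k. (x \<bullet> x) / (x \<bullet> x + e k)) \<longlonglongrightarrow> (x \<bullet> x) / (x \<bullet> x + 0)"
      using nz by (intro tendsto_intros e_lim)
    then show "(\<lambda>k. s k x) \<longlonglongrightarrow> 1"
      using that by (simp add: s_eq)
  qed
  \<comment> \<open>The origin has to be excluded: \<open>s k 0 = 0\<close> for all
    \<open>k\<close>, so \<open>s\<close> does not tend to 1 there.\<close>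
  have AE0: "AE x :: real^'n in lborel. x \<noteq> 0" by (rule AE_lborel_singleton)
  have q_eq: "(cmod (f x / of_real (norm x)))\<^sup>2 = N x / (norm x)\<^sup>2" for x
    by (simp add: N_def norm_divide power_divide)
  have Nint: "integrable lborel (\<lambda>x. N x / (norm x)\<^sup>2)"
  proof (rule integrableI_nonneg)
    have "(\<integral>\<^sup>+x. ennreal (N x / (norm x)\<^sup>2) \<partial>lborel) =
        (\<integral>\<^sup>+x. liminf (\<lambda>k. ennreal ((m k x)\<^sup>2 * N x)) \<partial>lborel)"
    proof (rule nn_integral_cong_AE, use AE0 in eventually_elim)
      case (elim x)
      have "(\<lambda>k. ennreal ((m k x)\<^sup>2 * N x)) \<longlonglongrightarrow> ennreal (1 / (norm x)\<^sup>2 * N x)"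
        by (intro tendsto_ennrealI tendsto_intros m_lim elim)
      from lim_imp_Liminf[OF _ this] show ?case by simp
    qed
    also have "\<dots> \<le> liminf (\<lambda>k. \<integral>\<^sup>+x. ennreal ((m k x)\<^sup>2 * N x) \<partial>lborel)"
      by (rule nn_integral_liminf) measurable
    also have "\<dots> \<le> ennreal (?A / ?c\<^sup>2)"
    proof -
      have "(\<integral>\<^sup>+x. ennreal ((m k x)\<^sup>2 * N x) \<partial>lborel) \<le> ennreal (?A / ?c\<^sup>2)" for k
        using Hardy[of k] mN[of k] by (subst nn_integral_eq_integral) (auto simp: N_def intro: ennreal_leI)
      then show ?thesis
        by (intro Liminf_le) auto
    qed
    finally show "(\<integral>\<^sup>+x. ennreal (N x / (norm x)\<^sup>2) \<partial>lborel) < \<infinity>"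
      by (simp add: le_less_trans)
  qed (auto simp: N_def)
  show q: "(\<lambda>x. f x / of_real (norm x)) \<in> L2"
    using Nint by (simp add: L2_def q_eq)
  \<comment> \<open>Only now is \<open>P\<close> a product of two \<open>L2\<close> functions;
    before the Fatou step only \<open>s k x * P x\<close> was known to be integrable.\<close>
  have Pint: "integrable lborel P"
    using integrable_L2_inner(2)[OF a q] unfolding P_def[abs_def] .
  have l1: "(\<lambda>k. LINT x|lborel. s k x * P x) \<longlonglongrightarrow> (LINT x|lborel. 1 * P x)"
  proof (rule integral_dominated_convergence[where w="\<lambda>x. \<bar>P x\<bar>"])
    show "AE x in lborel. (\<lambda>k. s k x * P x) \<longlonglongrightarrow> 1 * P x"
      using AE0 by eventually_elim (intro tendsto_intros s_lim)
    show "AE x in lborel. norm (s k x * P x) \<le> \<bar>P x\<bar>" for k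
      using s01[of k] by (auto simp: abs_mult intro!: AE_I2 mult_left_le_one_le)
  qed (use Pint sP in auto)
  \<comment> \<open>The majorant comes from \<open>0 \<le> d - s k x \<le> d\<close> and from
    \<open>(m k x)\<^sup>2\<close> being at most \<open>1 / (norm x)\<^sup>2\<close>.\<close>
  have l2: "(\<lambda>k. LINT x|lborel. (d - s k x) * ((m k x)\<^sup>2 * N x)) \<longlonglongrightarrow>
      (LINT x|lborel. (d - 1) * (1 / (norm x)\<^sup>2 * N x))"
  proof (rule integral_dominated_convergence[where w="\<lambda>x. d * (N x / (norm x)\<^sup>2)"])
    show "AE x in lborel. (\<lambda>k. (d - s k x) * ((m k x)\<^sup>2 * N x)) \<longlonglongrightarrow> (d - 1) * (1 / (norm x)\<^sup>2 * N x)"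
      using AE0 by eventually_elim (intro tendsto_intros s_lim m_lim)
    show "AE x in lborel. norm ((d - s k x) * ((m k x)\<^sup>2 * N x)) \<le> d * (N x / (norm x)\<^sup>2)" for k
      using AE0
    proof eventually_elim
      case (elim x)
      have "(m k x)\<^sup>2 \<le> 1 / (norm x)\<^sup>2"
        unfolding m2 power2_norm_eq_inner using e[of k] elim pos[of x k]
        by (intro divide_left_mono) auto
      then have "(m k x)\<^sup>2 * N x \<le> N x / (norm x)\<^sup>2"
        using mult_right_mono[of "(m k x)\<^sup>2" "1 / (norm x)\<^sup>2" "N x"] by (simp add: N_def)
      then have "(d - s k x) * ((m k x)\<^sup>2 * N x) \<le> d * (N x / (norm x)\<^sup>2)"
        using s01[of k x] d by (intro mult_mono) (auto simp: N_def)
      then show ?case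
        using s01[of k x] d by (simp add: abs_mult N_def)
    qed
    show "integrable lborel (\<lambda>x. d * (N x / (norm x)\<^sup>2))"
      using Nint by (rule integrable_mult_right)
  qed auto
  have "(LINT x|lborel. 1 * P x) = - (LINT x|lborel. (d - 1) * (1 / (norm x)\<^sup>2 * N x))"
    using LIMSEQ_unique[OF l1 tendsto_minus[OF l2, folded key]] .
  moreover have "(LINT x|lborel. (d - 1) * (1 / (norm x)\<^sup>2 * N x)) =
      (d - 1) * (LINT x|lborel. N x / (norm x)\<^sup>2)"
    by (subst integral_mult_right_zero) simp
  ultimately show "(LINT x|lborel. Re (radial_deriv g x * cnj (f x / of_real (norm x)))) =
      - (d - 1) * (LINT x|lborel. (cmod (f x / of_real (norm x)))\<^sup>2)"
    unfolding q_eq P_def by (simp only: mult_1 mult_minus_left)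
qed

section \<open>From (H) to (D)\<close>

text \<open>The radial identity is applied to \<open>m k x * f x\<close>, where \<open>m k\<close>
  approximates |x|. Dividing by |x| leaves \<open>\<alpha> k x * f x\<close> with
  \<open>\<alpha>\<close> between 0 and 1, so the integrability demanded by \<open>H\<close> is
  automatic. The derivative of \<open>m\<close> contributes an extra
  \<open>2 * \<theta> k x * N x\<close>, which tends to \<open>N x\<close> and raises the constant
  from \<open>d - 1\<close> to \<open>d\<close>.\<close>

lemma radial_identity_imp_dilation_identity:
  fixes f :: "real^'n::finite \<Rightarrow> complex"
  assumes H: "\<And>(\<psi> :: real^'n \<Rightarrow> complex) g.
      \<psi> \<in> H1 \<Longrightarrow> has_weak_gradient \<psi> g \<Longrightarrow> radial_deriv g \<in> L2 \<Longrightarrow>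
      (\<lambda>x. \<psi> x / of_real (norm x)) \<in> L2 \<Longrightarrow>
      (LINT x|lborel. Re (radial_deriv g x * cnj (\<psi> x / of_real (norm x)))) =
      - (d - 1) * (LINT x|lborel. (cmod (\<psi> x / of_real (norm x)))\<^sup>2)"
    and f: "f \<in> H1" "has_weak_gradient f g" and a: "dilation_deriv g \<in> L2"
  shows "(LINT x|lborel. Re (dilation_deriv g x * cnj (f x))) = - d * (LINT x|lborel. (cmod (f x))\<^sup>2)"
proof -
  define e where "e k = inverse (real (Suc k))" for k
  \<comment> \<open>\<open>p\<close> regularises 1/|x| at the origin, and \<open>q\<close> cuts off
    at infinity, where \<open>m\<close> would otherwise grow like |x|. The factor
    \<open>x \<bullet> x\<close> makes \<open>m\<close> vanish at the origin, so that m/|x| stays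
    bounded by 1.\<close>
  define p where "p k x = (x \<bullet> x + e k) powr (- 1 / 2)" for k and x :: "real^'n"
  define q where "q k x = 1 / (1 + e k * (x \<bullet> x))" for k and x :: "real^'n"
  define m where "m k x = (x \<bullet> x) * p k x * q k x" for k x
  \<comment> \<open>\<open>\<theta>\<close> is the logarithmic derivative of \<open>m\<close> with respect to \<open>ln (|x|\<^sup>2)\<close>, so \<open>x \<cdot> \<nabla>m = 2 m \<theta>\<close>;
    \<open>\<alpha> = m / |x|\<close>.\<close>
  define \<theta> where "\<theta> k x = 1 - (x \<bullet> x) * (p k x)\<^sup>2 / 2 - e k * (x \<bullet> x) * q k x" for k x
  define \<alpha> where "\<alpha> k x = norm x * p k x * q k x" for k x
  define N where "N x = (cmod (f x))\<^sup>2" for x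
  define P where "P x = Re (dilation_deriv g x * cnj (f x))" for x
  have e: "0 < e k" "e k \<le> 1" for k by (auto simp: e_def inverse_le_1_iff)
  have pos: "x \<bullet> x + e k > 0" "1 + e k * (x \<bullet> x) > 0" for x :: "real^'n" and k
    using e[of k] by (auto intro: add_nonneg_pos[OF inner_ge_zero] add_pos_nonneg)
  have p0: "p k x \<ge> 0" for k x by (simp add: p_def)
  have q01: "0 \<le> q k x" "q k x \<le> 1" for k x
    using pos(2)[of k x] e[of k] by (auto simp: q_def divide_le_eq_1)
  have p2: "(p k x)\<^sup>2 = 1 / (x \<bullet> x + e k)" for k x
    using pos(1)[of x k] by (simp add: p_def powr_minus_divide power2_eq_square flip: powr_add)
  have rp: "0 \<le> norm x * p k x" "norm x * p k x \<le> 1" for k x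
  proof -
    have "(norm x * p k x)\<^sup>2 \<le> 1"
      using pos(1)[of x k] e[of k]
      by (simp add: power_mult_distrib p2 power2_norm_eq_inner divide_le_eq_1)
    then show "norm x * p k x \<le> 1" "0 \<le> norm x * p k x"
      using p0[of k x] by (simp_all add: abs_square_le_1)
  qed
  have \<alpha>01: "0 \<le> \<alpha> k x" "\<alpha> k x \<le> 1" for k x
    unfolding \<alpha>_def using rp[of x k] q01[of k x] by (auto intro: mult_le_one)
  have m_\<alpha>: "m k x = norm x * \<alpha> k x" for k x
    by (simp add: m_def \<alpha>_def dot_square_norm power2_eq_square)
  \<comment> \<open>From 1 are subtracted a number in [0, 1/2] and a number in [0, 1].\<close>
  have \<theta>: "\<bar>\<theta> k x\<bar> \<le> 1" for k x
  proof -
    have "0 \<le> (x \<bullet> x) * (p k x)\<^sup>2" "(x \<bullet> x) * (p k x)\<^sup>2 \<le> 1"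
      using pos(1)[of x k] e[of k] by (auto simp: p2 divide_le_eq_1)
    moreover have "0 \<le> e k * (x \<bullet> x) * q k x" "e k * (x \<bullet> x) * q k x \<le> 1"
      using pos(2)[of k x] e[of k] by (auto simp: q_def divide_le_eq_1)
    ultimately show ?thesis unfolding \<theta>_def by linarith
  qed
  have m_le: "\<bar>m k x\<bar> \<le> 1 / e k" for k x
  proof -
    \<comment> \<open>With \<open>e k \<le> 1\<close> this bounds \<open>norm x * q k x\<close> by
      \<open>1 / e k\<close>; the other factor \<open>norm x * p k x\<close> of \<open>m\<close> is
      at most 1.\<close>
    have "norm x \<le> 1 + x \<bullet> x"
      using zero_le_power2[of "norm x - 1"] norm_ge_zero[of x]
      unfolding power2_norm_eq_inner[symmetric] power2_diff power_one mult_1_right by linarith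
    then have "e k * norm x \<le> e k * (1 + x \<bullet> x)"
      using e[of k] by (intro mult_left_mono) auto
    also have "\<dots> \<le> 1 + e k * (x \<bullet> x)"
      using e[of k] by (simp add: distrib_left)
    finally have "norm x * q k x \<le> 1 / e k"
      using pos(2)[of k x] e[of k] by (simp add: q_def field_simps)
    then have "(norm x * p k x) * (norm x * q k x) \<le> 1 * (1 / e k)"
      using rp[of x k] q01[of k x] by (intro mult_mono) auto
    then show ?thesis
      using \<alpha>01[of k x] by (simp add: m_\<alpha> \<alpha>_def mult_ac)
  qed
  have M': "((\<lambda>t. t * (t + e k) powr (- 1 / 2) * (1 / (1 + e k * t))) has_real_derivative
      p k x * q k x * \<theta> k x) (at (x \<bullet> x))" for k and x :: "real^'n"
  proof -
    have eq: "(x \<bullet> x + e k) powr (- 1 / 2 - 1) = p k x * (p k x)\<^sup>2"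
      unfolding powr_diff p2 using pos(1)[of x k] by (simp add: p_def)
    have dp: "((\<lambda>t. (t + e k) powr (- 1 / 2)) has_real_derivative - (p k x * (p k x)\<^sup>2) / 2) (at (x \<bullet> x))"
      using pos(1)[of x k] eq by (auto intro!: derivative_eq_intros)
    have dq: "((\<lambda>t. 1 / (1 + e k * t)) has_real_derivative - e k * (q k x)\<^sup>2) (at (x \<bullet> x))"
      using pos(2)[of k x] by (auto intro!: derivative_eq_intros simp: q_def power2_eq_square)
    show ?thesis
      by (rule DERIV_cong[OF DERIV_mult[OF DERIV_mult[OF DERIV_ident dp] dq]])
        (simp only: p_def[symmetric] q_def[symmetric], simp add: \<theta>_def algebra_simps power2_eq_square)
  qed
  have pm: "partial j (\<lambda>x. of_real (m k x)) x = of_real (2 * (p k x * q k x * \<theta> k x) * x $ j)" for j k x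
    using partial_radial[OF M'] unfolding m_def p_def q_def .
  have pm_le: "cmod (partial j (\<lambda>x. of_real (m k x)) x) \<le> 2" for j k x
  proof -
    have "\<bar>x $ j\<bar> * (p k x * q k x) \<le> \<alpha> k x"
      using component_le_norm_cart[of x j] p0[of k x] q01[of k x]
      by (simp add: \<alpha>_def mult.assoc mult_right_mono)
    with \<alpha>01[of k x] have "\<bar>x $ j\<bar> * (p k x * q k x) \<le> 1" by simp
    then have "(\<bar>x $ j\<bar> * (p k x * q k x)) * \<bar>\<theta> k x\<bar> \<le> 1"
      using \<theta> by (rule mult_le_one[OF _ abs_ge_zero])
    then show ?thesis
      unfolding pm norm_of_real using p0[of k x] q01[of k x]
      by (simp add: abs_mult mult_ac)
  qed
  have Cm: "C_k l (\<lambda>x. of_real (m k x))" for k l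
  proof -
    \<comment> \<open>Factoring out \<open>1 / e k\<close> turns \<open>q\<close> into a shifted
      radial power, the form covered by \<open>C_k_radial_powr\<close>.\<close>
    have q_powr: "q k x = (1 / e k) * (x \<bullet> x + 1 / e k) powr (- 1)" for x
      using pos(2)[of k x] e[of k] by (subst powr_minus_divide) (simp add: q_def field_simps)
    \<comment> \<open>\<open>x \<bullet> x\<close> is written as \<open>(x \<bullet> x + 1) powr 1 - 1\<close> to reuse smoothness of radial powers.\<close>
    have "(\<lambda>x. of_real (m k x) :: complex) = (\<lambda>x. (of_real ((x \<bullet> x + 1) powr 1) + of_real (- 1)) *
        of_real ((x \<bullet> x + e k) powr (- 1 / 2)) *
        (of_real (1 / e k) * of_real ((x \<bullet> x + 1 / e k) powr (- 1))))"
      by (simp add: m_def p_def q_powr add_nonneg_nonneg fun_eq_iff flip: of_real_mult)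
    moreover have "C_k l \<dots>"
      using e[of k] by (intro C_k_mult C_k_add C_k_const C_k_radial_powr) auto
    ultimately show ?thesis by (simp only:)
  qed
  have fL2: "f \<in> L2" using f by (simp add: H1_def)
  then have [measurable]: "f \<in> borel_measurable lborel"
    by (simp add: L2_def)
  have [measurable]: "(\<lambda>x. p k x) \<in> borel_measurable lborel" "(\<lambda>x. q k x) \<in> borel_measurable lborel" for k
    unfolding p_def q_def using pos
    by (auto intro!: borel_measurable_continuous_onI continuous_intros simp: less_imp_neq[symmetric])
  have [measurable]: "(\<lambda>x. \<theta> k x) \<in> borel_measurable lborel" "(\<lambda>x. \<alpha> k x) \<in> borel_measurable lborel" for k
    unfolding \<theta>_def \<alpha>_def by measurable
  have Nint: "integrable lborel N" and Pint: "integrable lborel P"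
    using fL2 integrable_L2_inner(2)[OF a fL2] by (auto simp: L2_def N_def[abs_def] P_def[abs_def])
  have [measurable]: "N \<in> borel_measurable lborel" "P \<in> borel_measurable lborel"
    using Nint Pint by auto

  have key: "(LINT x|lborel. (\<alpha> k x)\<^sup>2 * (P x + 2 * \<theta> k x * N x)) =
      - (d - 1) * (LINT x|lborel. (\<alpha> k x)\<^sup>2 * N x)" for k
  proof -
    let ?\<psi> = "\<lambda>x. of_real (m k x) * f x"
    let ?G = "\<lambda>j x. of_real (m k x) * g j x + partial j (\<lambda>x. of_real (m k x)) x * f x"
    have \<psi>: "?\<psi> \<in> H1"
      by (rule H1_mult[OF f(1) Cm, of _ "1 / e k" 2]) (use m_le pm_le in auto)
    have G: "radial_deriv ?G x = of_real (\<alpha> k x) * dilation_deriv g x + of_real (2 * \<alpha> k x * \<theta> k x) * f x" for x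
      unfolding radial_deriv_eq
      by (subst dilation_deriv_radial_mult[OF pm])
        (auto simp: m_\<alpha> add_divide_distrib \<alpha>_def dot_square_norm power2_eq_square)
    have \<psi>_eq: "?\<psi> x / of_real (norm x) = of_real (\<alpha> k x) * f x" for x
      by (auto simp: m_\<alpha> \<alpha>_def)
    have \<alpha>f: "(\<lambda>x. of_real (\<alpha> k x) * f x) \<in> L2"
      using \<alpha>01[of k] by (intro L2_bounded_mult[OF fL2, of _ 1]) auto
    have "cmod (of_real (2 * \<alpha> k x * \<theta> k x)) \<le> 2" for x
      using \<alpha>01[of k x] \<theta>[of k x] mult_le_one[of "\<alpha> k x" "\<bar>\<theta> k x\<bar>"]
      unfolding norm_of_real by (simp add: abs_mult)
    then have GL2: "radial_deriv ?G \<in> L2"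
      unfolding G using \<alpha>01[of k]
      by (intro L2_add L2_bounded_mult[OF a, of _ 1] L2_bounded_mult[OF fL2, of _ 2]) auto
    have "Re (radial_deriv ?G x * cnj (of_real (\<alpha> k x) * f x)) = (\<alpha> k x)\<^sup>2 * (P x + 2 * \<theta> k x * N x)" for x
      unfolding G P_def N_def by (simp add: cmod_power2) (simp add: power2_eq_square algebra_simps)
    moreover have "(cmod (of_real (\<alpha> k x) * f x))\<^sup>2 = (\<alpha> k x)\<^sup>2 * N x" for x
      by (simp add: norm_mult power_mult_distrib N_def)
    ultimately show ?thesis
      using H[OF \<psi> has_weak_gradient_mult[OF Cm f(2)] GL2] \<alpha>f unfolding \<psi>_eq by simp
  qed

  have e_lim: "e \<longlonglongrightarrow> 0"
    unfolding e_def[abs_def] by (rule LIMSEQ_inverse_real_of_nat)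
  have \<alpha>_lim: "(\<lambda>k. (\<alpha> k x)\<^sup>2) \<longlonglongrightarrow> 1" and \<theta>_lim: "(\<lambda>k. \<theta> k x) \<longlonglongrightarrow> 1 / 2" if "x \<noteq> 0" for x
  proof -
    have nz: "x \<bullet> x + 0 \<noteq> 0" using that by simp
    have s: "(\<lambda>k. (x \<bullet> x) / (x \<bullet> x + e k)) \<longlonglongrightarrow> (x \<bullet> x) / (x \<bullet> x + 0)"
      using nz by (intro tendsto_intros e_lim)
    have q: "(\<lambda>k. q k x) \<longlonglongrightarrow> 1 / (1 + 0 * (x \<bullet> x))"
      unfolding q_def by (intro tendsto_intros e_lim) simp
    have "(\<lambda>k. (x \<bullet> x) / (x \<bullet> x + e k) * (q k x)\<^sup>2) \<longlonglongrightarrow> (x \<bullet> x) / (x \<bullet> x + 0) * (1 / (1 + 0 * (x \<bullet> x)))\<^sup>2"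
      by (intro tendsto_intros s q)
    then show "(\<lambda>k. (\<alpha> k x)\<^sup>2) \<longlonglongrightarrow> 1"
      using that by (simp add: \<alpha>_def power_mult_distrib p2 power2_norm_eq_inner)
    have "(\<lambda>k. 1 - (x \<bullet> x) / (x \<bullet> x + e k) / 2 - e k * (x \<bullet> x) * q k x) \<longlonglongrightarrow>
        1 - (x \<bullet> x) / (x \<bullet> x + 0) / 2 - 0 * (x \<bullet> x) * (1 / (1 + 0 * (x \<bullet> x)))"
      by (intro tendsto_intros s q e_lim) simp
    then show "(\<lambda>k. \<theta> k x) \<longlonglongrightarrow> 1 / 2"
      using that by (simp add: \<theta>_def p2)
  qed
  have AE0: "AE x :: real^'n in lborel. x \<noteq> 0" by (rule AE_lborel_singleton)
  have \<alpha>2: "0 \<le> (\<alpha> k x)\<^sup>2" "(\<alpha> k x)\<^sup>2 \<le> 1" for k x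
    using \<alpha>01[of k x] by (auto simp: power_le_one)
  \<comment> \<open>The bounds 1 on \<open>(\<alpha> k x)\<^sup>2\<close> and on
    \<open>\<bar>\<theta> k x\<bar>\<close> give a majorant that involves only \<open>f\<close> and
    its dilation derivative.\<close>
  have l1: "(\<lambda>k. LINT x|lborel. (\<alpha> k x)\<^sup>2 * (P x + 2 * \<theta> k x * N x)) \<longlonglongrightarrow>
      (LINT x|lborel. 1 * (P x + 2 * (1 / 2) * N x))"
  proof (rule integral_dominated_convergence[where w="\<lambda>x. \<bar>P x\<bar> + 2 * N x"])
    show "AE x in lborel. (\<lambda>k. (\<alpha> k x)\<^sup>2 * (P x + 2 * \<theta> k x * N x)) \<longlonglongrightarrow> 1 * (P x + 2 * (1 / 2) * N x)"
      using AE0 by eventually_elim (intro tendsto_intros \<alpha>_lim \<theta>_lim)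
    show "AE x in lborel. norm ((\<alpha> k x)\<^sup>2 * (P x + 2 * \<theta> k x * N x)) \<le> \<bar>P x\<bar> + 2 * N x" for k
    proof (rule AE_I2)
      fix x
      have "\<bar>P x + 2 * \<theta> k x * N x\<bar> \<le> \<bar>P x\<bar> + 2 * (\<bar>\<theta> k x\<bar> * N x)"
        using abs_triangle_ineq[of "P x" "2 * \<theta> k x * N x"] by (simp add: abs_mult N_def mult.assoc)
      also have "\<dots> \<le> \<bar>P x\<bar> + 2 * N x"
        using mult_right_mono[OF \<theta>[of k x], of "N x"] by (simp add: N_def)
      finally have "1 * \<bar>P x + 2 * \<theta> k x * N x\<bar> \<le> \<bar>P x\<bar> + 2 * N x" by simp
      then show "norm ((\<alpha> k x)\<^sup>2 * (P x + 2 * \<theta> k x * N x)) \<le> \<bar>P x\<bar> + 2 * N x"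
        using mult_right_mono[OF \<alpha>2(2)[of k x], of "\<bar>P x + 2 * \<theta> k x * N x\<bar>"]
        by (simp add: abs_mult)
    qed
  qed (use Nint Pint in auto)
  have l2: "(\<lambda>k. LINT x|lborel. (\<alpha> k x)\<^sup>2 * N x) \<longlonglongrightarrow> (LINT x|lborel. 1 * N x)"
  proof (rule integral_dominated_convergence[where w="N"])
    show "AE x in lborel. (\<lambda>k. (\<alpha> k x)\<^sup>2 * N x) \<longlonglongrightarrow> 1 * N x"
      using AE0 by eventually_elim (intro tendsto_intros \<alpha>_lim)
    show "AE x in lborel. norm ((\<alpha> k x)\<^sup>2 * N x) \<le> N x" for k
      using \<alpha>2[of k] by (auto simp: abs_mult N_def intro!: AE_I2 mult_left_le_one_le)
  qed (use Nint in auto)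
  \<comment> \<open>Moving the integral of \<open>N\<close> from the left to the right changes the
    factor \<open>- (d - 1)\<close> into \<open>- d\<close>.\<close>
  have "(LINT x|lborel. 1 * (P x + 2 * (1 / 2) * N x)) = - (d - 1) * (LINT x|lborel. 1 * N x)"
    using LIMSEQ_unique[OF l1 tendsto_mult_left[OF l2, of "- (d - 1)", folded key]] .
  then show ?thesis
    unfolding P_def[symmetric] N_def[symmetric] using Nint Pint by (simp add: algebra_simps)
qed

section \<open>Equivalence of (D) and (H) for norms that may be infinite\<close>

theorem theorem3p3:
  fixes n :: real
  defines "n \<equiv> real CARD('n::finite)"
  assumes "CARD('n) \<ge> 3"
  shows
    "(\<forall>\<phi>\<in>(H1 :: (real^'n \<Rightarrow> complex) set). \<forall>g.
        has_weak_gradient \<phi> g \<and> dilation_deriv g \<in> L2 \<longrightarrow>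
        (L2_norm (dilation_deriv g))\<^sup>2 =
          (L2_norm (\<lambda>x. dilation_deriv g x + of_real (n / 2) * \<phi> x))\<^sup>2
          + ennreal ((n / 2)\<^sup>2) * (L2_norm \<phi>)\<^sup>2)
     \<longleftrightarrow>
     (\<forall>\<psi>\<in>(H1 :: (real^'n \<Rightarrow> complex) set). \<forall>g.
        has_weak_gradient \<psi> g \<longrightarrow>
        (L2_norm (radial_deriv g))\<^sup>2 =
          (L2_norm (\<lambda>x. radial_deriv g x + of_real ((n - 2) / (2 * norm x)) * \<psi> x))\<^sup>2
          + ennreal (((n - 2) / 2)\<^sup>2) * (L2_norm (\<lambda>x. \<psi> x / of_real (norm x)))\<^sup>2)"
    (is "?D \<longleftrightarrow> ?H")
proof -
  \<comment> \<open>With d = n/2 the constant in (H) is d - 1; the bound on the dimension enters as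
    d > 1.\<close>
  have n: "n / 2 > 0" "(n - 2) / 2 > 0" "n / 2 > 1" and c_eq: "(n - 2) / 2 = n / 2 - 1"
    using assms(2) by (auto simp: n_def field_simps)
  have rw: "(\<lambda>x. radial_deriv g x + of_real ((n - 2) / (2 * norm x)) * \<psi> x) =
      (\<lambda>x. radial_deriv g x + of_real ((n - 2) / 2) * (\<psi> x / of_real (norm x)))"
    for g and \<psi> :: "real^'n \<Rightarrow> complex"
    by (auto simp: fun_eq_iff)
  show ?thesis
  proof
    assume D: ?D
    show ?H
      unfolding rw
    proof (intro ballI allI impI)
      fix \<psi> :: "real^'n \<Rightarrow> complex" and g
      assume \<psi>: "\<psi> \<in> H1" "has_weak_gradient \<psi> g"
      let ?b = "\<lambda>x. \<psi> x / of_real (norm x)" and ?c = "(n - 2) / 2"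
      show "(L2_norm (radial_deriv g))\<^sup>2 =
          (L2_norm (\<lambda>x. radial_deriv g x + of_real ?c * ?b x))\<^sup>2 + ennreal (?c\<^sup>2) * (L2_norm ?b)\<^sup>2"
      proof (cases "radial_deriv g \<in> L2")
        case True
        have D': "(LINT x|lborel. Re (dilation_deriv g x * cnj (\<phi> x))) = - (n / 2) * (LINT x|lborel. (cmod (\<phi> x))\<^sup>2)"
          if "\<phi> \<in> H1" "has_weak_gradient \<phi> g" "dilation_deriv g \<in> L2" for \<phi> :: "real^'n \<Rightarrow> complex" and g
          using D L2_identity_iff[OF that(3) _ n(1), of \<phi>] that by (simp add: H1_def)
        have b: "?b \<in> L2"
          by (rule dilation_identity_imp_Hardy(1)[OF D' n(3) \<psi> True])
        show ?thesis
          unfolding L2_identity_iff[OF True b n(2)] unfolding c_eq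
          by (rule dilation_identity_imp_Hardy(2)[OF D' n(3) \<psi> True])
      next
        case False
        \<comment> \<open>The left-hand side is infinite, so some term on the right must be. If
          \<open>?b\<close> is in \<open>L2\<close>, the sum is not, since subtracting
          \<open>?c * ?b\<close> would put the radial derivative in \<open>L2\<close>; otherwise the
          last term is infinite because \<open>?c > 0\<close>.\<close>
        have "(\<lambda>x. radial_deriv g x + of_real ?c * ?b x) \<notin> L2" if "?b \<in> L2"
        proof
          assume *: "(\<lambda>x. radial_deriv g x + of_real ?c * ?b x) \<in> L2"
          have "(\<lambda>x. of_real (- ?c) * ?b x) \<in> L2"
            by (rule L2_bounded_mult[OF that, of _ "\<bar>- ?c\<bar>"])
              (simp_all only: norm_of_real measurable_const UNIV_I space_borel order_refl)
          from L2_add[OF * this] have "radial_deriv g \<in> L2" by simp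
          with False show False by simp
        qed
        moreover have "ennreal (?c\<^sup>2) * top = top"
          using n(2) by (simp add: ennreal_mult_top del: power_divide)
        ultimately show ?thesis
          using False by (cases "?b \<in> L2") (auto simp: L2_norm_def ennreal_top_mult power2_eq_square)
      qed
    qed
  next
    assume H: ?H
    have H': "(LINT x|lborel. Re (radial_deriv g x * cnj (\<psi> x / of_real (norm x)))) =
        - (n / 2 - 1) * (LINT x|lborel. (cmod (\<psi> x / of_real (norm x)))\<^sup>2)"
      if "\<psi> \<in> H1" "has_weak_gradient \<psi> g" "radial_deriv g \<in> L2" "(\<lambda>x. \<psi> x / of_real (norm x)) \<in> L2"
      for \<psi> :: "real^'n \<Rightarrow> complex" and g
      using H[unfolded rw] that unfolding c_eq[symmetric] L2_identity_iff[OF that(3,4) n(2), symmetric]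
      by blast
    show ?D
    proof (intro ballI allI impI, elim conjE)
      fix \<phi> :: "real^'n \<Rightarrow> complex" and g
      assume \<phi>: "\<phi> \<in> H1" "has_weak_gradient \<phi> g" "dilation_deriv g \<in> L2"
      then have "\<phi> \<in> L2" by (simp add: H1_def)
      show "(L2_norm (dilation_deriv g))\<^sup>2 =
          (L2_norm (\<lambda>x. dilation_deriv g x + of_real (n / 2) * \<phi> x))\<^sup>2 + ennreal ((n / 2)\<^sup>2) * (L2_norm \<phi>)\<^sup>2"
        unfolding L2_identity_iff[OF \<phi>(3) \<open>\<phi> \<in> L2\<close> n(1)]
        by (rule radial_identity_imp_dilation_identity[OF H' \<phi>])
    qed
  qed
qed

end
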